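(* No two distinct non-trivial cycles have the same signature. That is, if $(t_1,\dots,t_m)$ and $(t'_1,\dots,t'_m)$ are non-trivial cycles of length $m$ whose signatures satisfy $s_i=s'_i$ for all $i=1,\dots,m$, then $t_i=t'_i$ for all $i$.
   Context: The subprime Fibonacci rule: from positive integers $x,y$ with $s=x+y$, the next term is $s$ if $s$ is prime and $s/p$ if $s$ is composite, where $p$ is the smallest prime factor of $s$. A non-trivial cycle of length $m$ is an $m$-tuple $(t_1,\dots,t_m)$ of positive integers, indices read modulo $m$, such that for every $i$, $t_i$ is obtained from $t_{i-2},t_{i-1}$ by this rule, the $t_i$ are not all equal, and $m$ is the minimal period. Its signature is $(s_1,\dots,s_m)$ where $s_i=(t_{i-2}+t_{i-1})/t_i$ (so $s_i=1$ if $t_{i-2}+t_{i-1}$ is prime, and otherwise $s_i$ is the smallest prime factor of $t_{i-2}+t_{i-1}$). *)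

theory Defs
  imports Complex_Main "HOL-Computational_Algebra.Primes"
begin

definition smallest_prime_factor :: "nat \<Rightarrow> nat" where
  "smallest_prime_factor s = (LEAST p. prime p \<and> p dvd s)"

(* For positive x and y the sum is at least 2, so "not prime" means "composite". *)
definition subprime_next :: "nat \<Rightarrow> nat \<Rightarrow> nat" where
  "subprime_next x y =
     (if prime (x + y) then x + y else (x + y) div smallest_prime_factor (x + y))"

(* The tuple (t_1, ..., t_m) is a list of length m; "term_at t i" is t_i, with the
   integer index i read modulo m. The shift by 1 accounts for lists starting at 0. *)
definition term_at :: "nat list \<Rightarrow> int \<Rightarrow> nat" where
  "term_at t i = t ! nat ((i - 1) mod int (length t))"

definition nontrivial_cycle :: "nat \<Rightarrow> nat list \<Rightarrow> bool" where
  "nontrivial_cycle m t \<longleftrightarrow>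
     m \<ge> 1 \<and> length t = m \<and>
     (\<forall>i. term_at t i > 0) \<and>
     (\<forall>i. term_at t i = subprime_next (term_at t (i - 2)) (term_at t (i - 1))) \<and>
     (\<exists>i j. term_at t i \<noteq> term_at t j) \<and>
     \<not> (\<exists>d. 0 < d \<and> d < m \<and> (\<forall>i. term_at t (i + int d) = term_at t i))"

(* On a cycle this division is exact, see sig_cases below. *)
definition sig :: "nat list \<Rightarrow> int \<Rightarrow> nat" where
  "sig t i = (term_at t (i - 2) + term_at t (i - 1)) div term_at t i"

lemma smallest_prime_factor:
  assumes "s \<noteq> 1"
  shows "prime (smallest_prime_factor s)" "smallest_prime_factor s dvd s"
proof -
  obtain p where "prime p \<and> p dvd s"
    using prime_factor_nat[OF assms] by blast
  then have "prime (smallest_prime_factor s) \<and> smallest_prime_factor s dvd s"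
    unfolding smallest_prime_factor_def by (rule LeastI)
  then show "prime (smallest_prime_factor s)" "smallest_prime_factor s dvd s"
    by blast+
qed

lemma sig_cases:
  assumes "nontrivial_cycle m t"
  defines "s \<equiv> \<lambda>i. term_at t (i - 2) + term_at t (i - 1)"
  shows "term_at t i dvd s i"
    and "sig t i = (if prime (s i) then 1 else smallest_prime_factor (s i))"
proof -
  have pos: "term_at t j > 0" for j
    using assms(1) unfolding nontrivial_cycle_def by blast
  have t: "term_at t i = (if prime (s i) then s i else s i div smallest_prime_factor (s i))"
    using assms(1) unfolding nontrivial_cycle_def subprime_next_def s_def by blast
  have s2: "s i \<ge> 2"
    using pos[of "i - 2"] pos[of "i - 1"] unfolding s_def by linarith
  have eq: "sig t i = s i div term_at t i"
    unfolding sig_def s_def by simp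
  define p where "p = smallest_prime_factor (s i)"
  have "p > 0"
    using smallest_prime_factor(1)[of "s i"] s2 prime_gt_0_nat unfolding p_def by simp
  obtain k where k: "s i = p * k"
    using smallest_prime_factor(2)[of "s i"] s2 unfolding p_def by auto
  have "k > 0"
    using k s2 by (cases k) auto
  have t': "term_at t i = (if prime (s i) then s i else k)"
    using t k \<open>p > 0\<close> unfolding p_def[symmetric] by simp
  show "term_at t i dvd s i"
    using t' k by simp
  show "sig t i = (if prime (s i) then 1 else smallest_prime_factor (s i))"
    unfolding eq p_def[symmetric] using t' k \<open>k > 0\<close> s2 by auto
qed

end

theory Submission
  imports Defs
begin

text \<open>
  For a fixed signature \<open>s\<close> a cycle solves the linear system \<open>s\<^sub>i t\<^sub>i = t\<^sub>i\<^sub>-\<^sub>2 + t\<^sub>i\<^sub>-\<^sub>1\<close>, and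
  positive periodic solutions are proportional: if the ratio \<open>t'\<^sub>j / t\<^sub>j\<close> is maximal, then
  \<open>u\<^sub>i = t'\<^sub>j t\<^sub>i - t\<^sub>j t'\<^sub>i\<close> is a nonnegative solution vanishing at \<open>j\<close>, hence at \<open>j - 1\<close>, and so on
  backwards around the cycle. Moreover some \<open>s\<^sub>i\<close> is \<open>1\<close>, because otherwise every term is at most
  the mean of its two predecessors and the cycle is constant. There \<open>t\<^sub>i\<close> and \<open>t'\<^sub>i\<close> are primes; were
  they different, proportionality would make \<open>t\<^sub>i\<close> divide the smaller positive term \<open>t\<^sub>i\<^sub>-\<^sub>1\<close>.
\<close>

text \<open>Descent from \<open>j\<close> reaches only indices up to \<open>j\<close>; periodicity
  covers the rest, since subtracting enough multiples of \<open>m\<close> carries any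
  \<open>i\<close> below \<open>j\<close>.\<close>

lemma periodic_backward_induct:
  fixes P :: "int \<Rightarrow> bool" and m :: nat
  assumes "m > 0" and period: "\<And>i. P (i + int m) \<longleftrightarrow> P i"
    and "P j" and step: "\<And>i. P i \<Longrightarrow> P (i - 1)"
  shows "P i"
proof -
  have backward: "P (j - int n)" for n
  proof (induction n)
    case (Suc n)
    have "j - int (Suc n) = (j - int n) - 1" by simp
    with step[OF Suc.IH] show ?case by (simp only:)
  qed (use \<open>P j\<close> in simp)
  have shift: "P (i - int n * int m) \<longleftrightarrow> P i" for n
  proof (induction n)
    case (Suc n)
    have "i - int (Suc n) * int m + int m = i - int n * int m" by (simp add: algebra_simps)
    with period[of "i - int (Suc n) * int m"] Suc.IH show ?case by (simp only:)
  qed simp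
  \<comment> \<open>As \<open>m\<close> is at least 1, going back \<open>\<bar>i - j\<bar>\<close>
    whole periods is always enough.\<close>
  define n where "n = nat \<bar>i - j\<bar>"
  have "int n \<le> int n * int m" using \<open>m > 0\<close> by (simp add: mult_le_cancel_left1)
  then have "i - int n * int m \<le> j" unfolding n_def by linarith
  then have "i - int n * int m = j - int (nat (j - (i - int n * int m)))" by simp
  with backward[of "nat (j - (i - int n * int m))"] shift[of n] show ?thesis by simp
qed

text \<open>The offset \<open>k\<close> lets one congruence serve all three indices occurring in
  \<open>sig\<close>.\<close>

lemma term_at_cong:
  assumes "i mod int (length t) = j mod int (length t)"
  shows "term_at t (i + k) = term_at t (j + k)"
proof -
  have "(i + k - 1) mod int (length t) = (j + k - 1) mod int (length t)"
    using mod_add_cong[OF assms refl, of "k - 1"] by (simp add: algebra_simps)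
  then show ?thesis unfolding term_at_def by simp
qed

lemma term_at_period: "term_at t (i + int (length t)) = term_at t i"
  using term_at_cong[of "i + int (length t)" t i 0] by simp

lemma term_at_in_set: "t \<noteq> [] \<Longrightarrow> term_at t i \<in> set t"
  unfolding term_at_def by (intro nth_mem) (simp add: nat_less_iff)

lemma sig_cong:
  assumes "i mod int (length t) = j mod int (length t)"
  shows "sig t i = sig t j"
  using term_at_cong[OF assms, of "-2"] term_at_cong[OF assms, of "-1"]
    term_at_cong[OF assms, of 0]
  unfolding sig_def by simp

lemma nontrivial_cycleD:
  assumes "nontrivial_cycle m t"
  shows "length t = m" and "m > 0" and "term_at t i > 0"
    and "\<exists>i j. term_at t i \<noteq> term_at t j"
proof -
  from assms have "length t = m \<and> m \<ge> 1 \<and> (\<forall>i. term_at t i > 0)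
    \<and> (\<exists>i j. term_at t i \<noteq> term_at t j)"
    unfolding nontrivial_cycle_def by (elim conjE) (intro conjI)
  then show "length t = m" and "m > 0" and "term_at t i > 0"
    and "\<exists>i j. term_at t i \<noteq> term_at t j"
    by auto
qed

lemma sig_mult:
  assumes "nontrivial_cycle m t"
  shows "sig t i * term_at t i = term_at t (i - 2) + term_at t (i - 1)"
  using sig_cases(1)[OF assms, of i] unfolding sig_def by simp

lemma sig_one_imp_prime:
  assumes "nontrivial_cycle m t" and "sig t i = 1"
  shows "prime (term_at t i)" and "term_at t i = term_at t (i - 2) + term_at t (i - 1)"
proof -
  let ?s = "term_at t (i - 2) + term_at t (i - 1)"
  show eq: "term_at t i = ?s"
    using sig_mult[OF assms(1), of i] assms(2) by simp
  from nontrivial_cycleD(3)[OF assms(1), of "i - 2"] nontrivial_cycleD(3)[OF assms(1), of "i - 1"]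
  have "?s \<noteq> 1" by linarith
  \<comment> \<open>A smallest prime factor is never 1, so signature 1 can only come from the prime
    branch of the rule.\<close>
  from smallest_prime_factor(1)[OF this] have "smallest_prime_factor ?s \<noteq> 1" by (metis not_prime_1)
  with sig_cases(2)[OF assms(1), of i] assms(2) have "prime ?s" by argo
  with eq show "prime (term_at t i)" by simp
qed

lemma ex_sig_one:
  assumes cyc: "nontrivial_cycle m t"
  obtains i where "sig t i = 1"
proof (rule ccontr)
  assume "\<not> thesis"
  with that have no1: "sig t i \<noteq> 1" for i by blast
  note len = nontrivial_cycleD(1,2)[OF cyc] and pos = nontrivial_cycleD(3)[OF cyc]
    and nonconst = nontrivial_cycleD(4)[OF cyc]
  have two: "2 \<le> sig t i" for i
  proof -
    have "sig t i \<noteq> 0" using sig_mult[OF cyc, of i] pos[of "i - 1"] by (cases "sig t i") auto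
    with no1[of i] show ?thesis by linarith
  qed
  have mean: "2 * term_at t i \<le> term_at t (i - 2) + term_at t (i - 1)" for i
    using sig_mult[OF cyc, of i] mult_le_mono1[OF two[of i], of "term_at t i"] by simp
  have "range (term_at t) \<subseteq> set t" using term_at_in_set len by auto
  then have fin: "finite (range (term_at t))" using finite_subset by blast
  from Max_in[OF this] obtain j where j: "Max (range (term_at t)) = term_at t j" by auto
  have le: "term_at t i \<le> term_at t j" for i
    using Max_ge[OF fin] j by auto
  have "term_at t i = term_at t j" for i
  proof (rule periodic_backward_induct[OF \<open>m > 0\<close>, where P = "\<lambda>i. term_at t i = term_at t j"])
    \<comment> \<open>Two numbers bounded by the maximum whose mean is at least the maximum must
      both equal it.\<close>
    show "term_at t (i - 1) = term_at t j" if "term_at t i = term_at t j" for i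
      using that mean[of i] le[of "i - 1"] le[of "i - 2"] by linarith
  qed (use term_at_period len in auto)
  with nonconst show False by metis
qed

lemma same_sig_proportional:
  assumes cyc: "nontrivial_cycle m t" "nontrivial_cycle m t'"
    and sig: "\<And>i. sig t i = sig t' i"
  shows "term_at t i * term_at t' k = term_at t' i * term_at t k"
proof -
  note len = cyc[THEN nontrivial_cycleD(1)] nontrivial_cycleD(2)[OF cyc(1)]
    and pos = cyc[THEN nontrivial_cycleD(3)]
  define r where "r = (\<lambda>i. real (term_at t' i) / real (term_at t i))"
  \<comment> \<open>The ratios use only entries of two finite lists, so their maximum is
    attained.\<close>
  have "range r \<subseteq> (\<lambda>(x, y). real y / real x) ` (set t \<times> set t')"
    using len term_at_in_set[of t] term_at_in_set[of t'] unfolding r_def by force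
  then have fin: "finite (range r)" using finite_subset by blast
  from Max_in[OF this] obtain j where j: "Max (range r) = r j" by auto
  \<comment> \<open>Integers are used so that the subtraction is not truncated.\<close>
  define u where "u = (\<lambda>i. int (term_at t' j * term_at t i) - int (term_at t j * term_at t' i))"
  have nonneg: "u i \<ge> 0" for i
  proof -
    have "r i \<le> r j" using Max_ge[OF fin] j by auto
    then have "real (term_at t j * term_at t' i) \<le> real (term_at t' j * term_at t i)"
      using pos(1)[of i] pos(1)[of j] unfolding r_def by (simp add: field_simps)
    then show ?thesis unfolding u_def by linarith
  qed
  \<comment> \<open>The recurrence is linear with coefficients common to both cycles, so it passes
    to \<open>u\<close>.\<close>
  have rec: "int (sig t i) * u i = u (i - 2) + u (i - 1)" for i
  proof -
    have "int (sig t i) * int (term_at t i) = int (term_at t (i - 2)) + int (term_at t (i - 1))"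
      "int (sig t i) * int (term_at t' i) = int (term_at t' (i - 2)) + int (term_at t' (i - 1))"
      using sig_mult[OF cyc(1), of i] sig_mult[OF cyc(2), of i] sig[of i]
      by (metis of_nat_add of_nat_mult)+
    then show ?thesis unfolding u_def of_nat_mult by algebra
  qed
  have "u i = 0" for i
  proof (rule periodic_backward_induct[OF \<open>m > 0\<close>, where P = "\<lambda>i. u i = 0"])
    show "u (i + int m) = 0 \<longleftrightarrow> u i = 0" for i
      using term_at_period[of t i] term_at_period[of t' i] len unfolding u_def by simp
    show "u j = 0" unfolding u_def by simp
    \<comment> \<open>By \<open>rec\<close>, two nonnegative numbers then sum to zero.\<close>
    show "u (i - 1) = 0" if "u i = 0" for i
      using that rec[of i] nonneg[of "i - 1"] nonneg[of "i - 2"] by simp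
  qed
  then have proportion: "term_at t' j * term_at t i = term_at t j * term_at t' i" for i
    unfolding u_def by (metis eq_iff_diff_eq_0 of_nat_eq_iff)
  have "term_at t j * (term_at t i * term_at t' k) = term_at t j * (term_at t' i * term_at t k)"
    using proportion[of i] proportion[of k] by (metis mult.assoc mult.commute)
  with pos(1)[of j] show ?thesis by simp
qed

theorem theorem5:
  fixes m :: nat and t t' :: "nat list"
  assumes "nontrivial_cycle m t"
    and "nontrivial_cycle m t'"
    and "\<forall>i\<in>{1..int m}. sig t i = sig t' i"
  shows "\<forall>i\<in>{1..int m}. term_at t i = term_at t' i"
proof -
  note len = assms(1,2)[THEN nontrivial_cycleD(1)] nontrivial_cycleD(2)[OF assms(1)]
    and pos = nontrivial_cycleD(3)[OF assms(1)]
  have sig: "sig t i = sig t' i" for i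
  proof -
    \<comment> \<open>The shift by 1 picks the representative in \<open>1..m\<close>, sending
      multiples of \<open>m\<close> to \<open>m\<close> instead of 0.\<close>
    define k where "k = (i - 1) mod int m + 1"
    have "k \<in> {1..int m}" using len(3) unfolding k_def by (simp add: zless_imp_add1_zle)
    moreover have "k mod int m = i mod int m" unfolding k_def by (simp add: mod_simps)
    ultimately show ?thesis using assms(3) sig_cong len by metis
  qed
  obtain i where i: "sig t i = 1" using ex_sig_one[OF assms(1)] .
  have p: "prime (term_at t i)" and less: "term_at t (i - 1) < term_at t i"
    using sig_one_imp_prime[OF assms(1) i] pos[of "i - 2"] by simp_all
  have q: "prime (term_at t' i)" using sig_one_imp_prime(1)[OF assms(2)] i sig by metis
  note proportion = same_sig_proportional[OF assms(1,2) sig]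
  have "term_at t i dvd term_at t' i * term_at t (i - 1)"
    using proportion[of i "i - 1"] by (metis dvd_triv_left)
  moreover have "\<not> term_at t i dvd term_at t (i - 1)"
    using less pos[of "i - 1"] by (simp add: nat_dvd_not_less)
  ultimately have "term_at t i dvd term_at t' i"
    using p by (simp add: prime_dvd_mult_iff)
  with p q have eq: "term_at t i = term_at t' i" by (simp add: primes_dvd_imp_eq)
  \<comment> \<open>Equality at \<open>i\<close> makes the ratio of the two cycles 1.\<close>
  have "term_at t k = term_at t' k" for k
    using proportion[of i k] eq pos[of i] by simp
  then show ?thesis by blast
qed

end
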